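(* Let $G$ be a connected cubic graph with a $1$-factor $F$, and let $X=G/F$. Then $G$ is Hamiltonian if and only if $X$ contains a good Eulerian subgraph.
   Context: Let $Y=G-F$ be the complementary $2$-factor. $X=G/F$ is the quartic multigraph obtained by contracting each edge of $F$: each edge $e=uv\in F$ becomes a vertex $x_e$, and the edges of $Y$ become the edges of $X$ (possibly loops or parallel edges). The four edge-ends of $X$ at $x_e$ correspond to the four edge-ends of $Y$ at $u$ and $v$ (two at $u$, two at $v$). A transition at $x_e$ is an unordered pair of distinct edge-ends at $x_e$; it is non-traversing if both edge-ends come from the same end ($u$ or $v$) of $e$, and traversing otherwise (so there are $2$ non-traversing and $4$ traversing transitions at each vertex). Consider spanning subgraphs $W$ of $X$ in which every vertex has degree $2$ or $4$. Such a $W$ is admissible if at every vertex of degree $2$ in $W$ the transition formed by its two edge-ends in $W$ is traversing. A good Eulerian tour of $W$ is a closed walk traversing every edge of $W$ exactly once such that each passage through a vertex of degree $4$ in $W$ uses a non-traversing transition. A good Eulerian subgraph of $X$ is an admissible such $W$ possessing a good Eulerian tour. *)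

theory Defs
  imports "Graph_Theory.Graph_Theory"
begin

text \<open>
  A multigraph, loops and parallel edges allowed, is a bidirected digraph: an edge is a pair
  \<open>{a, arev a}\<close> of mutually reverse arcs. The arc \<open>a\<close> doubles as the end of that edge at
  \<open>tail G a\<close>, so a loop has two ends at its vertex, and the edge-ends at \<open>v\<close> and the degree of
  \<open>v\<close> are \<^term>\<open>out_arcs G v\<close> and \<^term>\<open>out_degree G v\<close>.
\<close>

definition edges :: "('a, 'b) pre_digraph \<Rightarrow> ('b \<Rightarrow> 'b) \<Rightarrow> 'b set set" where
  "edges G arev = (\<lambda>a. {a, arev a}) ` arcs G"

definition regular :: "nat \<Rightarrow> ('a, 'b) pre_digraph \<Rightarrow> bool" where
  "regular k G \<longleftrightarrow> (\<forall>v\<in>verts G. out_degree G v = k)"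

abbreviation cubic :: "('a, 'b) pre_digraph \<Rightarrow> bool" where
  "cubic \<equiv> regular 3"

text \<open>A subgraph of a multigraph contains with an arc also its reverse.\<close>

definition spanning_subgraph ::
    "('a, 'b) pre_digraph \<Rightarrow> ('a, 'b) pre_digraph \<Rightarrow> ('b \<Rightarrow> 'b) \<Rightarrow> bool" where
  "spanning_subgraph H G arev \<longleftrightarrow> spanning H G \<and> (\<forall>a\<in>arcs H. arev a \<in> arcs H)"

definition factor ::
    "nat \<Rightarrow> ('a, 'b) pre_digraph \<Rightarrow> ('a, 'b) pre_digraph \<Rightarrow> ('b \<Rightarrow> 'b) \<Rightarrow> bool" where
  "factor k H G arev \<longleftrightarrow> spanning_subgraph H G arev \<and> regular k H"

text \<open>
  \<^const>\<open>pre_digraph.cycle\<close> is a directed notion and would accept \<open>[a, arev a]\<close>; a cycle of the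
  multigraph must not run along an edge in both directions.
\<close>

definition hamiltonian_cycle ::
    "('a, 'b) pre_digraph \<Rightarrow> ('b \<Rightarrow> 'b) \<Rightarrow> 'b awalk \<Rightarrow> bool" where
  "hamiltonian_cycle G arev p \<longleftrightarrow>
     pre_digraph.cycle G p \<and> (\<forall>a\<in>set p. arev a \<notin> set p) \<and> tail G ` set p = verts G"

definition hamiltonian :: "('a, 'b) pre_digraph \<Rightarrow> ('b \<Rightarrow> 'b) \<Rightarrow> bool" where
  "hamiltonian G arev \<longleftrightarrow> (\<exists>p. hamiltonian_cycle G arev p)"

definition complement_factor ::
    "('a, 'b) pre_digraph \<Rightarrow> ('a, 'b) pre_digraph \<Rightarrow> ('a, 'b) pre_digraph" where
  "complement_factor G F = G\<lparr>arcs := arcs G - arcs F\<rparr>"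

text \<open>
  The vertex \<open>x\<^sub>e\<close> of \<open>G/F\<close> is the edge \<open>e = {a, arev a}\<close> of \<open>F\<close> itself; the ends of \<open>e\<close> in \<open>G\<close>
  are \<open>tail G ` e\<close>. The arcs of \<open>G/F\<close> are those of \<open>G - F\<close>, with the same reversal.
\<close>

definition factor_edge_at ::
    "('a, 'b) pre_digraph \<Rightarrow> ('b \<Rightarrow> 'b) \<Rightarrow> ('a, 'b) pre_digraph \<Rightarrow> 'a \<Rightarrow> 'b set" where
  "factor_edge_at G arev F v = (THE e. e \<in> edges F arev \<and> v \<in> tail G ` e)"

definition contraction ::
    "('a, 'b) pre_digraph \<Rightarrow> ('b \<Rightarrow> 'b) \<Rightarrow> ('a, 'b) pre_digraph \<Rightarrow> ('b set, 'b) pre_digraph" where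
  "contraction G arev F =
     (let Y = complement_factor G F in
      \<lparr>verts = edges F arev,
       arcs = arcs Y,
       tail = \<lambda>a. factor_edge_at G arev F (tail Y a),
       head = \<lambda>a. factor_edge_at G arev F (head Y a)\<rparr>)"

definition transition :: "('c, 'b) pre_digraph \<Rightarrow> 'c \<Rightarrow> 'b set \<Rightarrow> bool" where
  "transition X x t \<longleftrightarrow> t \<subseteq> out_arcs X x \<and> card t = 2"

definition non_traversing ::
    "('a, 'b) pre_digraph \<Rightarrow> ('b \<Rightarrow> 'b) \<Rightarrow> ('a, 'b) pre_digraph \<Rightarrow> 'b set \<Rightarrow> 'b set \<Rightarrow> bool" where
  "non_traversing G arev F x t \<longleftrightarrow>
     transition (contraction G arev F) x t \<and> (\<exists>v\<in>tail G ` x. \<forall>a\<in>t. tail G a = v)"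

definition traversing ::
    "('a, 'b) pre_digraph \<Rightarrow> ('b \<Rightarrow> 'b) \<Rightarrow> ('a, 'b) pre_digraph \<Rightarrow> 'b set \<Rightarrow> 'b set \<Rightarrow> bool" where
  "traversing G arev F x t \<longleftrightarrow>
     transition (contraction G arev F) x t \<and> \<not> non_traversing G arev F x t"

definition admissible ::
    "('a, 'b) pre_digraph \<Rightarrow> ('b \<Rightarrow> 'b) \<Rightarrow> ('a, 'b) pre_digraph \<Rightarrow> ('b set, 'b) pre_digraph \<Rightarrow> bool" where
  "admissible G arev F W \<longleftrightarrow>
     (\<forall>x\<in>verts W. out_degree W x = 2 \<longrightarrow> traversing G arev F x (out_arcs W x))"

text \<open>
  The passage between cyclically consecutive arcs \<open>a\<close>, \<open>b\<close> of a closed walk, at the vertex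
  \<open>head W a = tail W b\<close>, uses the edge-ends \<open>arev a\<close> and \<open>b\<close>.
\<close>

definition good_eulerian_tour ::
    "('a, 'b) pre_digraph \<Rightarrow> ('b \<Rightarrow> 'b) \<Rightarrow> ('a, 'b) pre_digraph \<Rightarrow> ('b set, 'b) pre_digraph \<Rightarrow>
      'b awalk \<Rightarrow> bool" where
  "good_eulerian_tour G arev F W p \<longleftrightarrow>
     (\<exists>x. pre_digraph.awalk W x p x) \<and>
     (\<forall>e\<in>edges W arev. \<exists>!i. i < length p \<and> p ! i \<in> e) \<and>
     (\<forall>i<length p.
        let a = p ! i; b = p ! (Suc i mod length p); x = tail W b in
        out_degree W x = 4 \<longrightarrow> non_traversing G arev F x {arev a, b})"

definition good_eulerian_subgraph ::
    "('a, 'b) pre_digraph \<Rightarrow> ('b \<Rightarrow> 'b) \<Rightarrow> ('a, 'b) pre_digraph \<Rightarrow> ('b set, 'b) pre_digraph \<Rightarrow> bool" where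
  "good_eulerian_subgraph G arev F W \<longleftrightarrow>
     spanning_subgraph W (contraction G arev F) arev \<and>
     (\<forall>x\<in>verts W. out_degree W x \<in> {2, 4}) \<and>
     admissible G arev F W \<and>
     (\<exists>p. good_eulerian_tour G arev F W p)"

end

theory Submission
  imports Defs
begin

text \<open>
  Deleting the arcs of \<open>F\<close> from a Hamiltonian cycle of \<open>G\<close> leaves a closed walk in \<open>X\<close>: two
  consecutive arcs of the cycle never both lie in \<open>F\<close>, so the walk only jumps across single edges
  of \<open>F\<close>. If the cycle uses the edge \<open>e\<close> of \<open>F\<close>, it has one further edge-end at each end of \<open>e\<close>, and
  \<open>x\<^sub>e\<close> gets degree 2 with a traversing transition; otherwise it passes through both ends of \<open>e\<close>
  without using \<open>e\<close>, and \<open>x\<^sub>e\<close> gets degree 4 with two non-traversing passages.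

  Conversely, lift a good Eulerian tour to \<open>G\<close> by inserting an arc of \<open>F\<close> wherever the tour jumps.
  Jumps occur only at vertices of degree 2. A vertex \<open>v\<close> of \<open>G\<close> is visited at most once: at degree 2,
  only one edge-end of \<open>W\<close> sits at \<open>v\<close>; at degree 4, every passage consumes both edge-ends of \<open>G - F\<close>
  at \<open>v\<close>.
\<close>

section \<open>Closed walks as cyclic lists of arcs\<close>

lemma successively_closed_conv_nth:
  assumes "p \<noteq> []"
  shows "successively R (p @ [hd p]) \<longleftrightarrow> (\<forall>i<length p. R (p ! i) (p ! (Suc i mod length p)))"
proof -
  have "(p @ [hd p]) ! Suc i = p ! (Suc i mod length p)" if "i < length p" for i
    using that assms by (cases "Suc i = length p") (auto simp: nth_append hd_conv_nth)
  then show ?thesis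
    by (auto simp: successively_conv_nth nth_append)
qed

text \<open>The cyclic index form matches the passages in \<open>good_eulerian_tour\<close>, so
  tours of \<open>W\<close> and cycles of \<open>G\<close> can be treated alike. The empty list is
  excluded because \<open>hd []\<close> is unspecified.\<close>

lemma (in pre_digraph) cas_closed_iff:
  assumes "p \<noteq> []"
  shows "cas u p u \<longleftrightarrow>
    tail G (hd p) = u \<and> (\<forall>i<length p. head G (p ! i) = tail G (p ! (Suc i mod length p)))"
proof -
  have *: "cas u p v \<longleftrightarrow> tail G (hd p) = u \<and>
      successively (\<lambda>a b. head G a = tail G b) p \<and> head G (last p) = v" for v
    using assms by (induction p arbitrary: u rule: induct_list012) auto
  have "successively (\<lambda>a b. head G a = tail G b) (p @ [hd p]) \<longleftrightarrow>
      successively (\<lambda>a b. head G a = tail G b) p \<and> head G (last p) = tail G (hd p)"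
    using assms by (auto simp: successively_append_iff)
  then show ?thesis
    unfolding * using successively_closed_conv_nth[OF assms, of "\<lambda>a b. head G a = tail G b"]
    by auto
qed

text \<open>Going round a closed walk shifts tails to heads by one place, so distinctness and range
  of the tails carry over to the heads.\<close>

lemma closed_map_head:
  assumes "\<forall>i<length p. head G (p ! i) = tail G (p ! (Suc i mod length p))"
  shows "map (head G) p = rotate1 (map (tail G) p)"
  using assms
  by (intro nth_equalityI)
    (auto simp: nth_rotate1, metis length_pos_if_in_set mod_less_divisor nth_map nth_mem)

text \<open>\<open>tl (awalk_verts u p)\<close> lists the heads of \<open>p\<close>, which are a
  rotation of its tails. This form does not mention a base point.\<close>

lemma (in wf_digraph) cycle_iff:
  "cycle p \<longleftrightarrow> p \<noteq> [] \<and> set p \<subseteq> arcs G \<and>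
    (\<forall>i<length p. head G (p ! i) = tail G (p ! (Suc i mod length p))) \<and> distinct (map (tail G) p)"
proof (cases "p = []")
  case False
  have "distinct (tl (awalk_verts u p)) \<longleftrightarrow> distinct (map (tail G) p)" if "cas u p u" for u
  proof -
    have "map (head G) p = rotate1 (map (tail G) p)"
      using that False by (intro closed_map_head) (simp add: cas_closed_iff)
    then show ?thesis
      using that False by (simp add: awalk_verts_conv')
  qed
  then show ?thesis
    using False hd_in_set[OF False] tail_in_verts
    by (auto simp: cycle_def awalk_def cas_closed_iff simp del: hd_in_set)
qed (simp add: cycle_def)

lemma distinct_concat_map_upt:
  assumes "\<And>i. i < n \<Longrightarrow> distinct (g i)"
    and "\<And>i j. i < j \<Longrightarrow> j < n \<Longrightarrow> set (g i) \<inter> set (g j) = {}"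
  shows "distinct (concat (map g [0..<n]))"
  using assms
proof (induction n)
  case (Suc n)
  then have "distinct (concat (map g [0..<n]))"
    by simp
  with Suc.prems show ?case
    by fastforce
qed simp

text \<open>No two adjacent elements are dropped, so at most one dropped \<open>c\<close> separates
  consecutive survivors. The induction peels off one element if the second survives and two
  otherwise; a surviving last element guarantees that something follows a dropped one.\<close>

lemma successively_filter:
  assumes "successively R xs" "xs = [] \<or> (P (hd xs) \<and> P (last xs))"
    and "\<And>a b. R a b \<Longrightarrow> P a \<or> P b"
  shows "successively (\<lambda>a b. R a b \<or> (\<exists>c. \<not> P c \<and> R a c \<and> R c b)) (filter P xs)"
    (is "successively ?S _")
  using assms(1,2)
proof (induction xs rule: length_induct)
  case (1 xs)
  show ?case
  proof (cases xs rule: remdups_adj.cases)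
    case (3 a b ys)
    then have ab: "R a b" "P a" "successively R (b # ys)" "P (last (b # ys))"
      using 1(2,3) by auto
    show ?thesis
    proof (cases "P b")
      case True
      then have "successively ?S (filter P (b # ys))"
        using ab 3 by (intro 1(1)[rule_format]) auto
      then show ?thesis
        using True ab 3 by simp
    next
      case False
      then obtain c zs where ys: "ys = c # zs"
        using ab by (cases ys) auto
      then have c: "R b c" "P c"
        using ab False assms(3)[of b c] by auto
      then have "successively ?S (filter P ys)"
        using ab 3 ys by (intro 1(1)[rule_format]) auto
      moreover have "?S a c"
        using ab(1) c(1) False by blast
      ultimately show ?thesis
        using ab(2) c(2) False 3 ys by simp
    qed
  qed auto
qed

text \<open>Rotate the cyclic list to begin at the survivor \<open>a\<close> and append its head.
  The resulting linear list has surviving ends, and filtering commutes with appending the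
  head.\<close>

lemma closed_successively_filter:
  assumes "\<forall>i<length q. R (q ! i) (q ! (Suc i mod length q))"
    and "a \<in> set q" "P a" and "\<And>a b. R a b \<Longrightarrow> P a \<or> P b"
  obtains p where "p \<noteq> []" "set p = {a \<in> set q. P a}" "distinct q \<longrightarrow> distinct p"
    "\<forall>i<length p. R (p ! i) (p ! (Suc i mod length p)) \<or>
      (\<exists>c. \<not> P c \<and> R (p ! i) c \<and> R c (p ! (Suc i mod length p)))"
proof -
  obtain m where m: "m < length q" "q ! m = a"
    using assms(2) by (auto simp: in_set_conv_nth)
  define r where "r = rotate m q"
  have r: "r \<noteq> []" "length r = length q" "set r = set q" "distinct r \<longleftrightarrow> distinct q"
    using m by (auto simp: r_def)
  have hd: "hd r = a"
    using m r by (simp add: r_def hd_rotate_conv_nth)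
  have "\<forall>i<length r. R (r ! i) (r ! (Suc i mod length r))"
  proof (intro allI impI)
    fix i assume i: "i < length r"
    have "r ! i = q ! ((m + i) mod length q)"
      "r ! (Suc i mod length r) = q ! (Suc ((m + i) mod length q) mod length q)"
      using i r m by (auto simp: r_def nth_rotate mod_simps)
    moreover have "(m + i) mod length q < length q"
      using m(1) by (intro mod_less_divisor) linarith
    ultimately show "R (r ! i) (r ! (Suc i mod length r))"
      using assms(1) by simp
  qed
  then have "successively R (r @ [hd r])"
    using r successively_closed_conv_nth[of r R] by simp
  then have "successively (\<lambda>a b. R a b \<or> (\<exists>c. \<not> P c \<and> R a c \<and> R c b)) (filter P (r @ [hd r]))"
    using assms(3,4) r hd by (intro successively_filter) auto
  moreover have "filter P (r @ [hd r]) = filter P r @ [hd (filter P r)]"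
    using assms(3) r hd by (cases r) auto
  moreover have ne: "filter P r \<noteq> []"
    using assms(2,3) r by (auto simp: filter_empty_conv)
  ultimately show ?thesis
    using r successively_closed_conv_nth[OF ne] by (intro that[of "filter P r"]) auto
qed

section \<open>A 1-factor as a fixed-point-free involution on the vertices\<close>

locale one_factor = bidirected_digraph G arev for G :: "('a, 'b) pre_digraph" and arev +
  fixes F :: "('a, 'b) pre_digraph"
  assumes one_factor: "factor 1 F G arev"
begin

definition factor_arc :: "'a \<Rightarrow> 'b" where
  "factor_arc v = (THE a. a \<in> arcs F \<and> tail G a = v)"

abbreviation "mate v \<equiv> head G (factor_arc v)"
abbreviation "fedge \<equiv> factor_edge_at G arev F"
abbreviation "X \<equiv> contraction G arev F"

lemma F_subset: "a \<in> arcs F \<Longrightarrow> a \<in> arcs G"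
  and F_arev: "arev a \<in> arcs F \<longleftrightarrow> a \<in> arcs F"
  using one_factor unfolding factor_def spanning_subgraph_def spanning_def subgraph_def
  by (blast, metis arev_arev)

lemma ex1_factor_arc: "v \<in> verts G \<Longrightarrow> \<exists>!a. a \<in> arcs F \<and> tail G a = v"
proof -
  assume v: "v \<in> verts G"
  have "card {a \<in> arcs F. tail G a = v} = 1"
    using one_factor v
    unfolding factor_def spanning_subgraph_def spanning_def subgraph_def compatible_def
      regular_def out_degree_def out_arcs_def
    by simp
  then obtain x where "{a \<in> arcs F. tail G a = v} = {x}"
    by (auto simp: card_1_singleton_iff)
  then show ?thesis
    by (intro ex1I[of _ x]) (auto simp: set_eq_iff)
qed

lemma factor_arc: "v \<in> verts G \<Longrightarrow> factor_arc v \<in> arcs F"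
  and tail_factor_arc [simp]: "v \<in> verts G \<Longrightarrow> tail G (factor_arc v) = v"
  using theI'[OF ex1_factor_arc] unfolding factor_arc_def by blast+

lemma factor_arc_tail: "a \<in> arcs F \<Longrightarrow> factor_arc (tail G a) = a"
  by (metis F_subset ex1_factor_arc factor_arc tail_factor_arc tail_in_verts)

lemma factor_arc_eq: "a \<in> arcs F \<Longrightarrow> tail G a = v \<Longrightarrow> factor_arc v = a"
  using factor_arc_tail by auto

lemma mate_in_verts [simp]: "v \<in> verts G \<Longrightarrow> mate v \<in> verts G"
  using factor_arc F_subset by auto

lemma factor_arc_mate [simp]: "v \<in> verts G \<Longrightarrow> factor_arc (mate v) = arev (factor_arc v)"
  by (metis F_arev F_subset factor_arc factor_arc_tail tail_arev)

lemma mate_mate [simp]: "v \<in> verts G \<Longrightarrow> mate (mate v) = v"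
  using factor_arc F_subset by auto

lemma mate_neq: "v \<in> verts G \<Longrightarrow> mate v \<noteq> v"
  by (metis F_subset arev_neq factor_arc factor_arc_mate)

text \<open>An edge of \<open>F\<close> meets \<open>v\<close> as the tail of one of its two arcs,
  and that arc can only be \<open>factor_arc v\<close>; so the description in
  \<open>factor_edge_at\<close> is unique.\<close>

lemma fedge_eq:
  assumes "v \<in> verts G"
  shows "fedge v = {factor_arc v, arev (factor_arc v)}"
  unfolding factor_edge_at_def
proof (rule the_equality)
  show "{factor_arc v, arev (factor_arc v)} \<in> edges F arev \<and>
      v \<in> tail G ` {factor_arc v, arev (factor_arc v)}"
    using assms factor_arc by (auto simp: edges_def)
next
  fix e assume "e \<in> edges F arev \<and> v \<in> tail G ` e"
  then obtain a where a: "a \<in> arcs F" "e = {a, arev a}" "v = tail G a \<or> v = tail G (arev a)"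
    by (auto simp: edges_def)
  then show "e = {factor_arc v, arev (factor_arc v)}"
    using factor_arc_tail[of a] factor_arc_tail[of "arev a"] F_arev by auto
qed

lemma fedge_mate [simp]: "v \<in> verts G \<Longrightarrow> fedge (mate v) = fedge v"
  by (auto simp: fedge_eq)

lemma fedge_eq_iff:
  assumes "u \<in> verts G" "v \<in> verts G"
  shows "fedge u = fedge v \<longleftrightarrow> u = v \<or> u = mate v"
proof
  assume "fedge u = fedge v"
  then have "factor_arc u = factor_arc v \<or> factor_arc u = factor_arc (mate v)"
    using assms by (auto simp: fedge_eq doubleton_eq_iff)
  then show "u = v \<or> u = mate v"
    using assms by (metis mate_in_verts tail_factor_arc)
qed (use assms in auto)

lemma tail_fedge: "v \<in> verts G \<Longrightarrow> tail G ` fedge v = {v, mate v}"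
  using factor_arc F_subset by (auto simp: fedge_eq)

section \<open>The contraction, its transitions and its spanning subgraphs\<close>

lemma verts_X: "verts X = fedge ` verts G"
proof -
  have "edges F arev = (\<lambda>v. {factor_arc v, arev (factor_arc v)}) ` verts G"
    unfolding edges_def
    using factor_arc factor_arc_tail F_subset
    by (auto simp: image_iff) (metis tail_in_verts)
  then show ?thesis
    by (simp add: contraction_def Let_def fedge_eq)
qed

lemma arcs_X: "arcs X = arcs G - arcs F"
  and tail_X: "tail X a = fedge (tail G a)"
  and head_X: "head X a = fedge (head G a)"
  by (simp_all add: contraction_def complement_factor_def Let_def)

lemma wf_X: "wf_digraph X"
  by unfold_locales (auto simp: verts_X arcs_X tail_X head_X)

lemma out_arcs_X:
  "v \<in> verts G \<Longrightarrow>
    out_arcs X (fedge v) = {a \<in> arcs G - arcs F. tail G a = v \<or> tail G a = mate v}"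
  by (auto simp: out_arcs_def arcs_X tail_X fedge_eq_iff)

text \<open>Every edge-end at \<open>fedge v\<close> has tail \<open>v\<close> or
  \<open>mate v\<close>, so a common tail is automatically an end of the contracted edge.
  Transitions thus reduce to comparing tails in \<open>G\<close>.\<close>

lemma non_traversing_iff:
  assumes "v \<in> verts G" "c \<in> out_arcs X (fedge v)" "d \<in> out_arcs X (fedge v)" "c \<noteq> d"
  shows "non_traversing G arev F (fedge v) {c, d} \<longleftrightarrow> tail G c = tail G d"
    and "traversing G arev F (fedge v) {c, d} \<longleftrightarrow> tail G c \<noteq> tail G d"
proof -
  have "transition X (fedge v) {c, d}"
    using assms by (simp add: transition_def)
  moreover have "(\<exists>u\<in>tail G ` fedge v. \<forall>a\<in>{c, d}. tail G a = u) \<longleftrightarrow> tail G c = tail G d"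
  proof -
    have "tail G c \<in> tail G ` fedge v"
      using assms(2) unfolding tail_fedge[OF assms(1)] out_arcs_X[OF assms(1)] by blast
    then show ?thesis
      by (metis insert_iff singletonD)
  qed
  ultimately show "non_traversing G arev F (fedge v) {c, d} \<longleftrightarrow> tail G c = tail G d"
    "traversing G arev F (fedge v) {c, d} \<longleftrightarrow> tail G c \<noteq> tail G d"
    unfolding traversing_def non_traversing_def by blast+
qed

lemma spanning_X:
  assumes "spanning_subgraph W X arev"
  shows "verts W = fedge ` verts G" "arcs W \<subseteq> arcs G - arcs F"
    "tail W a = fedge (tail G a)" "head W a = fedge (head G a)"
    "arev a \<in> arcs W \<longleftrightarrow> a \<in> arcs W"
proof -
  have W: "verts W = verts X" "arcs W \<subseteq> arcs X" "tail W = tail X" "head W = head X"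
    "\<And>a. a \<in> arcs W \<Longrightarrow> arev a \<in> arcs W"
    using assms unfolding spanning_subgraph_def spanning_def subgraph_def compatible_def
    by auto
  show "verts W = fedge ` verts G" "arcs W \<subseteq> arcs G - arcs F"
    "tail W a = fedge (tail G a)" "head W a = fedge (head G a)"
    using W(1-4) by (simp_all add: verts_X arcs_X tail_X head_X)
  show "arev a \<in> arcs W \<longleftrightarrow> a \<in> arcs W"
    using W(5)[of a] W(5)[of "arev a"] by auto
qed

lemma out_arcs_W:
  assumes "spanning_subgraph W X arev" "v \<in> verts G"
  shows "out_arcs W (fedge v) = {a \<in> arcs W. tail G a = v \<or> tail G a = mate v}"
  using assms spanning_X[OF assms(1)] by (auto simp: out_arcs_def fedge_eq_iff)

section \<open>From a Hamiltonian cycle to a good Eulerian subgraph\<close>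

lemma hamiltonian_imp_good_eulerian_subgraph:
  assumes "hamiltonian_cycle G arev q"
  obtains W where "good_eulerian_subgraph G arev F W"
proof -
  let ?Q = "set q"
  have q: "q \<noteq> []" "?Q \<subseteq> arcs G" "distinct (map (tail G) q)"
      "\<forall>i<length q. head G (q ! i) = tail G (q ! (Suc i mod length q))"
    and norev: "\<And>a. a \<in> ?Q \<Longrightarrow> arev a \<notin> ?Q" and tails: "tail G ` ?Q = verts G"
    using assms by (auto simp: hamiltonian_cycle_def cycle_iff)
  have heads: "map (head G) q = rotate1 (map (tail G) q)"
    using q(4) by (rule closed_map_head)
  have "set (map (head G) q) = set (map (tail G) q)" "distinct (map (head G) q)"
    unfolding heads using q(3) by simp_all
  then have head_surj: "head G ` ?Q = verts G" and inj: "inj_on (head G) ?Q" "inj_on (tail G) ?Q"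
    using tails q(3) by (auto simp: distinct_map)
  \<comment> \<open>Tails and heads both map the arcs of the cycle bijectively onto the vertices;
    the inverses give the cycle arc leaving and the cycle arc entering each vertex.\<close>
  define out where "out = inv_into ?Q (tail G)"
  define inc where "inc = inv_into ?Q (head G)"
  have out: "out v \<in> ?Q \<and> tail G (out v) = v" if "v \<in> verts G" for v
    using that tails by (metis out_def inv_into_into f_inv_into_f)
  have inc: "inc v \<in> ?Q \<and> head G (inc v) = v" if "v \<in> verts G" for v
    using that head_surj by (metis inc_def inv_into_into f_inv_into_f)
  have out_eq: "a = out v" if "a \<in> ?Q" "tail G a = v" for a v
    using that inj(2) unfolding out_def by auto
  have inc_eq: "a = inc v" if "a \<in> ?Q" "head G a = v" for a v
    using that inj(1) unfolding inc_def by auto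

  \<comment> \<open>The cycle holds only one arc of each of its edges, so \<open>W\<close> has to be
    closed under reversal explicitly.\<close>
  define W where "W = \<lparr>verts = verts X, arcs = {a \<in> arcs G - arcs F. a \<in> ?Q \<or> arev a \<in> ?Q},
    tail = tail X, head = head X\<rparr>"
  have W: "verts W = verts X" "arcs W = {a \<in> arcs G - arcs F. a \<in> ?Q \<or> arev a \<in> ?Q}"
    "tail W = tail X" "head W = head X"
    by (simp_all add: W_def)
  have "wf_digraph W"
    by unfold_locales (auto simp: W verts_X tail_X head_X)
  then have span: "spanning_subgraph W X arev"
    unfolding spanning_subgraph_def spanning_def subgraph_def compatible_def
    using wf_X by (auto simp: W arcs_X F_arev)

  define A where "A v = {a \<in> arcs W. tail G a = v}" for v
  have out_W: "out_arcs W (fedge v) = A v \<union> A (mate v)" if "v \<in> verts G" for v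
    using out_arcs_W[OF span that] by (auto simp: A_def)
  \<comment> \<open>The edge-ends of the cycle at \<open>v\<close> are \<open>out v\<close> and the
    reverse of \<open>inc v\<close>; those in \<open>F\<close> disappear in
    \<open>W\<close>.\<close>
  have A_eq: "A v = {out v, arev (inc v)} - arcs F" if v: "v \<in> verts G" for v
  proof (intro equalityI subsetI)
    fix a assume "a \<in> A v"
    then have a: "a \<in> arcs G" "a \<notin> arcs F" "tail G a = v" "a \<in> ?Q \<or> arev a \<in> ?Q"
      by (auto simp: A_def W)
    from a(4) have "a = out v \<or> arev a = inc v"
      using a(1,3) out_eq[of a v] inc_eq[of "arev a" v] by auto
    then show "a \<in> {out v, arev (inc v)} - arcs F"
      using a(2) by (metis Diff_iff arev_arev insertCI)
  next
    fix a assume "a \<in> {out v, arev (inc v)} - arcs F"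
    then show "a \<in> A v"
      using out[OF v] inc[OF v] q(2) by (auto simp: A_def W)
  qed
  have out_neq: "out v \<noteq> arev (inc v)" if "v \<in> verts G" for v
    using out[OF that] inc[OF that] norev by metis
  have F_at: "a = factor_arc v" if "a \<in> arcs F" "tail G a = v" for a v
    using that factor_arc_eq by simp
  define used where "used v \<longleftrightarrow> factor_arc v \<in> ?Q \<or> arev (factor_arc v) \<in> ?Q" for v
  have used_mate: "used (mate v) \<longleftrightarrow> used v" if "v \<in> verts G" for v
    using that by (auto simp: used_def)
  \<comment> \<open>One of the two cycle ends at \<open>v\<close> is \<open>factor_arc v\<close>.
    The other differs from it by \<open>out_neq\<close>, hence lies outside \<open>F\<close> and
    alone survives.\<close>
  have A_used: "\<exists>c. A v = {c}" if v: "v \<in> verts G" and u: "used v" for v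
  proof (cases "factor_arc v \<in> ?Q")
    case True
    then have *: "out v = factor_arc v"
      using out_eq v by (metis tail_factor_arc)
    then have "arev (inc v) \<notin> arcs F"
      using out_neq[OF v] F_at[of "arev (inc v)" v] inc[OF v] q(2) by auto
    then show ?thesis
      using A_eq[OF v] * factor_arc[OF v] by auto
  next
    case False
    then have "arev (factor_arc v) \<in> ?Q"
      using u by (simp add: used_def)
    then have "arev (factor_arc v) = inc v"
      using inc_eq v factor_arc F_subset by simp
    then have *: "arev (inc v) = factor_arc v"
      by (metis arev_arev)
    then have "out v \<notin> arcs F"
      using out_neq[OF v] F_at[of "out v" v] out[OF v] by auto
    then show ?thesis
      using A_eq[OF v] * factor_arc[OF v] by auto
  qed
  have A_unused: "A v = {out v, arev (inc v)}" if v: "v \<in> verts G" and u: "\<not> used v" for v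
  proof -
    have "out v \<notin> arcs F"
      using F_at[of "out v" v] out[OF v] u by (auto simp: used_def)
    moreover have "arev (inc v) \<notin> arcs F"
    proof
      assume "arev (inc v) \<in> arcs F"
      moreover have "tail G (arev (inc v)) = v"
        using inc[OF v] q(2) by auto
      ultimately have "arev (factor_arc v) = inc v"
        using F_at by (metis arev_arev)
      then show False
        using u inc[OF v] by (simp add: used_def)
    qed
    ultimately show ?thesis
      using A_eq[OF v] by auto
  qed
  have disj: "A v \<inter> A (mate v) = {}" if "v \<in> verts G" for v
    using mate_neq[OF that] by (auto simp: A_def)
  have used_out: "\<exists>c d. out_arcs W (fedge v) = {c, d} \<and> c \<noteq> d \<and> tail G c \<noteq> tail G d"
    if v: "v \<in> verts G" and u: "used v" for v
  proof -
    obtain c d where "A v = {c}" "A (mate v) = {d}"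
      using A_used[OF v u] A_used[of "mate v"] used_mate v u by auto
    moreover from this have "tail G c = v" "tail G d = mate v"
      unfolding A_def by blast+
    ultimately show ?thesis
      using out_W[OF v] mate_neq[OF v] by (intro exI[of _ c] exI[of _ d]) auto
  qed
  have unused_deg: "out_degree W (fedge v) = 4" if v: "v \<in> verts G" and u: "\<not> used v" for v
  proof -
    have "card (A v) = 2" "card (A (mate v)) = 2" "finite (A v)" "finite (A (mate v))"
      using A_unused v u used_mate out_neq by auto
    then show ?thesis
      unfolding out_degree_def out_W[OF v] using disj[OF v] by (simp add: card_Un_disjoint)
  qed
  have used_deg: "out_degree W (fedge v) = 2" if "v \<in> verts G" "used v" for v
    using used_out[OF that] by (auto simp: out_degree_def)
  have out_sub: "out_arcs W x \<subseteq> out_arcs X x" for x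
    by (auto simp: out_arcs_def W arcs_X)

  have adm: "admissible G arev F W"
    unfolding admissible_def
  proof (intro ballI impI)
    fix x assume "x \<in> verts W" "out_degree W x = 2"
    then obtain v where v: "v \<in> verts G" "x = fedge v" "used v"
      using unused_deg by (fastforce simp: W verts_X)
    obtain c d where cd: "out_arcs W x = {c, d}" "c \<noteq> d" "tail G c \<noteq> tail G d"
      using used_out[OF v(1,3)] v(2) by auto
    then have "c \<in> out_arcs X x" "d \<in> out_arcs X x"
      using out_sub[of x] by auto
    then show "traversing G arev F x (out_arcs W x)"
      using non_traversing_iff(2)[OF v(1)] cd v(2) by simp
  qed

  \<comment> \<open>Membership in the cycle is part of \<open>?R\<close> because \<open>R_F\<close>
    needs \<open>norev\<close>: two consecutive arcs of \<open>F\<close> would be mutually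
    reverse.\<close>
  let ?R = "\<lambda>a b. a \<in> ?Q \<and> b \<in> ?Q \<and> head G a = tail G b"
  have R_cyc: "\<forall>i<length q. ?R (q ! i) (q ! (Suc i mod length q))"
    using q(1,4) by simp
  have R_F: "a \<notin> arcs F \<or> b \<notin> arcs F" if "?R a b" for a b
  proof (rule ccontr)
    assume "\<not> ?thesis"
    then have "arev a = b"
      using that factor_arc_tail[of b] factor_arc_tail[of "arev a"] F_arev F_subset by auto
    then show False
      using that norev by auto
  qed
  \<comment> \<open>Of the first arc and its cyclic successor, one lies outside \<open>F\<close>;
    filtering can start there.\<close>
  have "\<exists>a\<in>?Q. a \<notin> arcs F"
    using R_cyc[rule_format, of 0] q(1) R_F by blast
  then obtain a\<^sub>0 where a0: "a\<^sub>0 \<in> ?Q" "a\<^sub>0 \<notin> arcs F"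
    by blast
  obtain p where p: "p \<noteq> []" "set p = {a \<in> ?Q. a \<notin> arcs F}" "distinct q \<longrightarrow> distinct p"
    "\<forall>i<length p. ?R (p ! i) (p ! (Suc i mod length p)) \<or>
      (\<exists>c. \<not> c \<notin> arcs F \<and> ?R (p ! i) c \<and> ?R c (p ! (Suc i mod length p)))"
    by (rule closed_successively_filter[of q ?R a\<^sub>0 "\<lambda>a. a \<notin> arcs F", OF R_cyc a0 R_F]) blast
  have p_arcs: "set p \<subseteq> arcs W"
    using p(2) q(2) by (auto simp: W)
  have dist: "distinct p"
    using p(3) q(3) by (simp add: distinct_map)
  have closed: "head W (p ! i) = tail W (p ! (Suc i mod length p))" if i: "i < length p" for i
  proof -
    \<comment> \<open>An arc of \<open>F\<close> joins two vertices with the same image in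
      \<open>X\<close>, so dropping it does not break the walk there.\<close>
    have "fedge (head G c) = fedge (tail G c)" if "c \<in> arcs F" for c
      using factor_arc_tail[OF that] fedge_mate[of "tail G c"] F_subset[OF that] by simp
    then have "fedge (head G a) = fedge (tail G b)"
      if "?R a b \<or> (\<exists>c. \<not> c \<notin> arcs F \<and> ?R a c \<and> ?R c b)" for a b
      using that by metis
    from this[OF p(4)[rule_format, OF i]] show ?thesis
      unfolding W(3,4) head_X tail_X .
  qed
  have "good_eulerian_tour G arev F W p"
    unfolding good_eulerian_tour_def
  proof (intro conjI ballI allI impI)
    have "pre_digraph.cas W (tail W (hd p)) p (tail W (hd p))"
      by (simp add: pre_digraph.cas_closed_iff[OF p(1)] closed)
    moreover have "tail W (hd p) \<in> verts W"
      using p_arcs hd_in_set[OF p(1)] \<open>wf_digraph W\<close> by (auto simp: wf_digraph_def)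
    ultimately show "\<exists>x. pre_digraph.awalk W x p x"
      using p_arcs by (auto simp: pre_digraph.awalk_def)
  next
    fix e assume "e \<in> edges W arev"
    then obtain a where "e = {a, arev a}" "a \<notin> arcs F" "a \<in> ?Q \<or> arev a \<in> ?Q"
      by (auto simp: edges_def W)
    then obtain b where b: "e = {b, arev b}" "b \<in> ?Q" "b \<notin> arcs F"
      by (metis F_arev arev_arev insert_commute)
    then obtain i where i: "i < length p" "p ! i = b"
      using p(2) by (metis (mono_tags, lifting) in_set_conv_nth mem_Collect_eq)
    show "\<exists>!i. i < length p \<and> p ! i \<in> e"
    proof (intro ex1I[of _ i] conjI)
      fix j assume j: "j < length p \<and> p ! j \<in> e"
      then have "p ! j \<in> ?Q"
        using p(2) nth_mem by blast
      then have "p ! j = b"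
        using j b norev by auto
      then show "j = i"
        using i j dist nth_eq_iff_index_eq by metis
    qed (use i b in auto)
  next
    fix i assume i: "i < length p"
    define a b where "a = p ! i" and "b = p ! (Suc i mod length p)"
    have b: "b \<in> ?Q" "b \<notin> arcs F" "b \<in> arcs G" and a: "a \<in> ?Q" "a \<notin> arcs F" "a \<in> arcs G"
      using p(1,2) i q(2) nth_mem[of i p] nth_mem[of "Suc i mod length p" p]
      by (auto simp: a_def b_def)
    define v where "v = tail G b"
    have v: "v \<in> verts G"
      using b by (simp add: v_def)
    have "non_traversing G arev F (fedge v) {arev a, b}" if "out_degree W (fedge v) = 4"
    proof -
      have nu: "\<not> used v"
        using that used_deg[OF v] by auto
      \<comment> \<open>An arc of \<open>F\<close> preceding \<open>b\<close> on the cycle would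
        make \<open>v\<close> used. So nothing was dropped between \<open>a\<close> and
        \<open>b\<close>, and the cycle itself passes from \<open>a\<close> to \<open>b\<close> at
        \<open>v\<close>.\<close>
      have "\<not> ?R c b" if "c \<in> arcs F" for c
      proof
        assume R: "?R c b"
        then have "factor_arc v = arev c"
          using that F_arev F_subset by (intro factor_arc_eq) (auto simp: v_def)
        then show False
          using nu R by (simp add: used_def)
      qed
      then have "head G a = v"
        using p(4) i by (auto simp: v_def a_def b_def)
      then have "arev a \<in> out_arcs X (fedge v)" "b \<in> out_arcs X (fedge v)" "tail G (arev a) = tail G b"
        using a b by (auto simp: out_arcs_def arcs_X tail_X F_arev v_def)
      moreover have "arev a \<noteq> b"
        using norev a b by auto
      ultimately show ?thesis
        using non_traversing_iff(1)[OF v] by simp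
    qed
    then show "let a = p ! i; b = p ! (Suc i mod length p); x = tail W b in
        out_degree W x = 4 \<longrightarrow> non_traversing G arev F x {arev a, b}"
      by (simp add: Let_def W tail_X v_def a_def b_def)
  qed
  moreover have "\<forall>x\<in>verts W. out_degree W x \<in> {2, 4}"
    using used_deg unused_deg by (auto simp: W verts_X)
  ultimately show ?thesis
    using that span adm unfolding good_eulerian_subgraph_def by blast
qed

section \<open>From a good Eulerian subgraph to a Hamiltonian cycle\<close>

lemma card_non_factor_arcs:
  assumes "cubic G" "v \<in> verts G"
  shows "card {a \<in> arcs G - arcs F. tail G a = v} = 2"
proof -
  have 3: "card (out_arcs G v) = 3"
    using assms by (simp add: regular_def out_degree_def)
  have "{a \<in> arcs G - arcs F. tail G a = v} = out_arcs G v - {factor_arc v}"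
    using factor_arc[OF assms(2)] factor_arc_eq[of _ v] by (auto simp: out_arcs_def)
  moreover have "factor_arc v \<in> out_arcs G v"
    using factor_arc F_subset assms(2) by (simp add: out_arcs_def)
  ultimately show ?thesis
    using 3 by simp
qed

lemma good_eulerian_subgraph_imp_hamiltonian:
  assumes cubic: "cubic G" and W: "good_eulerian_subgraph G arev F W"
  obtains q where "hamiltonian_cycle G arev q"
proof -
  from W obtain p where span: "spanning_subgraph W X arev"
    and deg: "\<And>v. v \<in> verts G \<Longrightarrow> out_degree W (fedge v) = 2 \<or> out_degree W (fedge v) = 4"
    and adm: "\<And>v. v \<in> verts G \<Longrightarrow> out_degree W (fedge v) = 2 \<Longrightarrow>
      traversing G arev F (fedge v) (out_arcs W (fedge v))"
    and tour: "good_eulerian_tour G arev F W p"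
    using spanning_X(1)[of W] unfolding good_eulerian_subgraph_def admissible_def by auto
  note spanW = spanning_X[OF span]
  obtain x where walk: "pre_digraph.awalk W x p x"
    using tour by (auto simp: good_eulerian_tour_def)
  have p_arcs: "set p \<subseteq> arcs W" and "x \<in> verts W"
    using walk by (auto simp: pre_digraph.awalk_def)
  define n where "n = length p"
  define nxt where "nxt i = Suc i mod n" for i
  have tour_edge: "\<exists>!i. i < n \<and> p ! i \<in> e" if "e \<in> edges W arev" for e
    using tour that unfolding good_eulerian_tour_def n_def by simp
  have once: "i = j" if "i < n" "j < n" "p ! j = p ! i \<or> p ! j = arev (p ! i)" for i j
  proof -
    have "{p ! i, arev (p ! i)} \<in> edges W arev"
      using p_arcs that(1) nth_mem unfolding edges_def n_def by blast
    from tour_edge[OF this] show ?thesis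
      using that by auto
  qed
  have covered: "\<exists>i<n. p ! i = a \<or> arev (p ! i) = a" if "a \<in> arcs W" for a
  proof -
    have "{a, arev a} \<in> edges W arev"
      using that by (auto simp: edges_def)
    from tour_edge[OF this] obtain i where "i < n" "p ! i \<in> {a, arev a}"
      by blast
    then show ?thesis
      by auto
  qed
  \<comment> \<open>The base vertex has positive degree in \<open>W\<close>, and the tour must cover
    the edges there.\<close>
  have p_ne: "p \<noteq> []"
  proof -
    obtain v where v: "v \<in> verts G" "x = fedge v"
      using \<open>x \<in> verts W\<close> spanW(1) by auto
    then have "out_arcs W x \<noteq> {}"
      using deg[OF v(1)] by (auto simp: out_degree_def)
    then show ?thesis
      using covered by (auto simp: n_def out_arcs_def)
  qed
  then have n: "0 < n" and nxt: "nxt i < n" for i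
    by (simp_all add: n_def nxt_def)
  have pW: "p ! i \<in> arcs W" "arev (p ! i) \<in> arcs W" if "i < n" for i
    using that p_arcs spanW(5) by (auto simp: n_def)
  then have pG: "p ! i \<in> arcs G" "p ! i \<notin> arcs F" if "i < n" for i
    using that spanW(2) by blast+
  \<comment> \<open>By \<open>once\<close>, equality would force \<open>i = j\<close>, but no arc of
    \<open>G\<close> is its own reverse.\<close>
  have norev: "p ! j \<noteq> arev (p ! i)" if "i < n" "j < n" for i j
    using once[OF that] arev_neq pG(1) that by metis
  have closed: "fedge (head G (p ! i)) = fedge (tail G (p ! nxt i))" if "i < n" for i
    using that walk pre_digraph.cas_closed_iff[OF p_ne, of W x] spanW(3,4)
    by (simp add: pre_digraph.awalk_def n_def nxt_def)
  have out_sub: "out_arcs W x \<subseteq> out_arcs X x" for x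
    using spanW by (auto simp: out_arcs_def arcs_X tail_X)
  have passage4: "head G (p ! i) = tail G (p ! nxt i)"
    if i: "i < n" and 4: "out_degree W (fedge (tail G (p ! nxt i))) = 4" for i
  proof -
    let ?v = "tail G (p ! nxt i)"
    have v: "?v \<in> verts G"
      using pG(1)[OF nxt] by simp
    have "non_traversing G arev F (fedge ?v) {arev (p ! i), p ! nxt i}"
      using tour i 4 unfolding good_eulerian_tour_def
      by (simp add: Let_def spanW(3) n_def nxt_def)
    moreover have "p ! nxt i \<in> out_arcs X (fedge ?v)" "arev (p ! i) \<in> out_arcs X (fedge ?v)"
      using closed[OF i] pG[OF i] pG[OF nxt[of i]]
      by (auto simp: out_arcs_def arcs_X tail_X F_arev)
    moreover have "arev (p ! i) \<noteq> p ! nxt i"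
      using norev[OF i nxt[of i]] by simp
    ultimately have "tail G (arev (p ! i)) = ?v"
      using non_traversing_iff(1)[OF v] by simp
    then show ?thesis
      using pG[OF i] by simp
  qed
  \<comment> \<open>Two distinct edge-ends at \<open>v\<close> would exhaust the degree 2 and form a
    non-traversing transition, against admissibility.\<close>
  have deg2: "c = d"
    if 2: "out_degree W (fedge v) = 2" and v: "v \<in> verts G"
      and cd: "c \<in> arcs W" "d \<in> arcs W" "tail G c = v" "tail G d = v" for c d v
  proof (rule ccontr)
    assume neq: "c \<noteq> d"
    have sub: "{c, d} \<subseteq> out_arcs W (fedge v)"
      using cd by (auto simp: out_arcs_W[OF span v])
    moreover have "finite (out_arcs W (fedge v))" "card (out_arcs W (fedge v)) = 2"
      using 2 by (auto simp: out_degree_def intro: card_ge_0_finite)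
    ultimately have "out_arcs W (fedge v) = {c, d}"
      using neq by (metis card_2_iff card_subset_eq)
    moreover have "c \<in> out_arcs X (fedge v)" "d \<in> out_arcs X (fedge v)"
      using sub out_sub by blast+
    ultimately show False
      using adm[OF v 2] non_traversing_iff(2)[OF v _ _ neq] cd(3,4) by metis
  qed
  \<comment> \<open>Adding \<open>n\<close> before subtracting 1 avoids truncation at
    \<open>i = 0\<close>.\<close>
  have prev: "\<exists>j<n. nxt j = i" if "i < n" for i
    using that n by (intro exI[of _ "(i + n - 1) mod n"]) (auto simp: nxt_def mod_simps)

  \<comment> \<open>The lifted tour must cross the edge of \<open>F\<close> between \<open>p ! i\<close> and its successor.\<close>
  define jump where "jump i \<longleftrightarrow> head G (p ! i) \<noteq> tail G (p ! nxt i)" for i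
  have jump2: "out_degree W (fedge (head G (p ! i))) = 2" if "i < n" "jump i" for i
    using that passage4[OF that(1)] deg[of "head G (p ! i)"] closed pG
    by (auto simp: jump_def)
  have jump_mate: "tail G (p ! nxt i) = mate (head G (p ! i))" if "i < n" "jump i" for i
    using that closed[OF that(1)] pG(1)[OF that(1)] pG(1)[OF nxt[of i]]
      fedge_eq_iff[of "tail G (p ! nxt i)" "head G (p ! i)"]
    by (auto simp: jump_def)
  have tail_inj: "i = j" if ij: "i < n" "j < n" "tail G (p ! i) = tail G (p ! j)" for i j
  proof -
    let ?v = "tail G (p ! i)"
    have v: "?v \<in> verts G"
      using pG[OF ij(1)] by simp
    from deg[OF v] show ?thesis
    proof
      assume "out_degree W (fedge ?v) = 2"
      then have "p ! i = p ! j"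
        using deg2[OF _ v] pW ij by simp
      then show ?thesis
        using once ij by metis
    next
      assume 4: "out_degree W (fedge ?v) = 4"
      obtain k l where k: "k < n" "nxt k = i" and l: "l < n" "nxt l = j"
        using prev ij by metis
      have hk: "head G (p ! k) = ?v" and hl: "head G (p ! l) = ?v"
        using passage4[OF k(1)] passage4[OF l(1)] 4 k l ij(3) by simp_all
      \<comment> \<open>Only two arcs outside \<open>F\<close> leave \<open>?v\<close>. The reverse
        of the arriving arc \<open>p ! k\<close> takes one of them and differs from both
        \<open>p ! i\<close> and \<open>p ! j\<close>, so these coincide.\<close>
      let ?N = "{a \<in> arcs G - arcs F. tail G a = ?v}"
      have "card ?N = 2"
        using card_non_factor_arcs[OF cubic v] .
      moreover have "{arev (p ! k), p ! i, p ! j} \<subseteq> ?N"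
        using hk pG k l ij by (auto simp: F_arev)
      ultimately have "card {arev (p ! k), p ! i, p ! j} \<le> 2"
        by (metis (no_types, lifting) card_ge_0_finite card_mono zero_less_numeral)
      moreover have "arev (p ! k) \<noteq> p ! i" "arev (p ! k) \<noteq> p ! j"
        using norev k ij by metis+
      ultimately have "p ! i = p ! j"
        by (auto simp: card_insert_if split: if_splits)
      then show ?thesis
        using once ij by metis
    qed
  qed
  have tail_jump: "tail G (p ! i) \<noteq> head G (p ! j)" if ij: "i < n" "j < n" "jump j" for i j
  proof
    assume eq: "tail G (p ! i) = head G (p ! j)"
    \<comment> \<open>A jump occurs at degree 2, where the arriving edge-end is the only one of
      \<open>W\<close> at its vertex of \<open>G\<close>; leaving from there would retrace the
      edge.\<close>
    have "arev (p ! j) = p ! i"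
      using jump2[OF ij(2,3)] ij pG pW eq by (intro deg2) auto
    then show False
      using norev ij by metis
  qed
  have jump_inj: "i = j"
    if ij: "i < n" "jump i" "j < n" "jump j" "head G (p ! i) = head G (p ! j)" for i j
  proof -
    have "arev (p ! j) = arev (p ! i)"
      using jump2[OF ij(1,2)] ij pG pW by (intro deg2) auto
    then show ?thesis
      using once ij by (metis arev_arev)
  qed

  define g where
    "g i = p ! i # (if jump i then [factor_arc (head G (p ! i))] else [])" for i
  define q where "q = concat (map g [0..<n])"
  have set_q: "set q = (\<Union>i<n. set (g i))"
    by (auto simp: q_def)
  have mem_g: "a \<in> set (g i) \<longleftrightarrow> a = p ! i \<or> jump i \<and> a = factor_arc (head G (p ! i))" for a i
    by (auto simp: g_def)
  have hv: "head G (p ! i) \<in> verts G" if "i < n" for i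
    using pG[OF that] by simp
  have q_arcs: "set q \<subseteq> arcs G"
    using pG hv factor_arc F_subset by (auto simp: set_q mem_g)
  have tails_g: "set (map (tail G) (g i)) =
      {tail G (p ! i)} \<union> (if jump i then {head G (p ! i)} else {})" if "i < n" for i
    using hv[OF that] by (auto simp: g_def)
  \<comment> \<open>An inserted arc starts at the head of the arc before it. So the tails of
    \<open>q\<close> are the tails of the tour arcs and the heads of the jumping ones, kept apart by
    \<open>tail_inj\<close>, \<open>tail_jump\<close> and \<open>jump_inj\<close>.\<close>
  have "distinct (concat (map (\<lambda>i. map (tail G) (g i)) [0..<n]))"
  proof (rule distinct_concat_map_upt)
    fix i assume "i < n"
    then show "distinct (map (tail G) (g i))"
      using tail_jump[of i i] hv by (auto simp: g_def)
  next
    fix i j assume "i < j" "j < n"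
    then show "set (map (tail G) (g i)) \<inter> set (map (tail G) (g j)) = {}"
      using tail_inj[of i j] tail_jump[of i j] tail_jump[of j i] jump_inj[of i j]
      by (auto simp: tails_g simp del: set_map)
  qed
  moreover have "map (tail G) q = concat (map (\<lambda>i. map (tail G) (g i)) [0..<n])"
    by (simp add: q_def map_concat comp_def)
  ultimately have dist: "distinct (map (tail G) q)"
    by simp
  \<comment> \<open>The induction runs over prefixes; the index \<open>m mod n\<close> makes the
    case \<open>m = n\<close> return to the start.\<close>
  have cas: "cas (tail G (p ! 0)) (concat (map g [0..<m])) (tail G (p ! (m mod n)))" if "m \<le> n" for m
    using that
  proof (induction m)
    case (Suc m)
    have "cas (tail G (p ! m)) (g m) (tail G (p ! nxt m))"
      using jump_mate[of m] Suc.prems hv by (auto simp: g_def jump_def)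
    moreover have "cas (tail G (p ! 0)) (concat (map g [0..<m])) (tail G (p ! m))"
      using Suc by simp
    ultimately show ?case
      using awlast_if_cas[of "tail G (p ! 0)" "concat (map g [0..<m])" "tail G (p ! m)"]
      by (simp add: nxt_def cas_append_iff)
  qed simp
  have q_ne: "q \<noteq> []"
    using n by (auto simp: q_def g_def)
  have "\<exists>u. cas u q u"
    using cas[of n] n by (auto simp: q_def)
  then have "cycle q"
    using q_ne q_arcs dist by (auto simp: cycle_iff cas_closed_iff)
  moreover have "\<forall>a\<in>set q. arev a \<notin> set q"
  proof (intro ballI notI)
    fix a assume "a \<in> set q" "arev a \<in> set q"
    then obtain i j where ij: "i < n" "j < n" "a \<in> set (g i)" "arev a \<in> set (g j)"
      by (auto simp: set_q)
    show False
    proof (cases "a \<in> arcs F")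
      case True
      then have i: "jump i" "a = factor_arc (head G (p ! i))"
        and j: "jump j" "arev a = factor_arc (head G (p ! j))"
        using ij(3,4) pG(2)[OF ij(1)] pG(2)[OF ij(2)] F_arev[of a] by (metis mem_g)+
      \<comment> \<open>If both directions of an edge of \<open>F\<close> were inserted, the tour
        arc after jump \<open>i\<close> would start where jump \<open>j\<close> begins, against
        \<open>tail_jump\<close>.\<close>
      have "tail G (p ! nxt i) = tail G (arev a)"
        using jump_mate[OF ij(1) i(1)] i(2) True F_subset by simp
      then have "tail G (p ! nxt i) = head G (p ! j)"
        using j(2) hv[OF ij(2)] by simp
      then show False
        using tail_jump nxt ij(2) j(1) by blast
    next
      case False
      then have "a = p ! i" "arev a = p ! j"
        using ij(3,4) factor_arc[OF hv] ij(1,2) F_arev[of a] by (metis mem_g)+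
      then show False
        using norev[OF ij(1,2)] by simp
    qed
  qed
  moreover have "tail G ` set q = verts G"
  proof (intro equalityI subsetI)
    fix v assume v: "v \<in> verts G"
    \<comment> \<open>At degree 2, a traversing transition has an edge-end on each side; at degree
      4, \<open>mate v\<close> can supply only two of the four.\<close>
    have "\<exists>c\<in>arcs W. tail G c = v"
      using deg[OF v]
    proof
      assume 2: "out_degree W (fedge v) = 2"
      then obtain c d where cd: "out_arcs W (fedge v) = {c, d}" "c \<noteq> d"
        by (auto simp: out_degree_def card_2_iff)
      then have "tail G c \<noteq> tail G d"
        using adm[OF v 2] non_traversing_iff(2)[OF v _ _ cd(2)] out_sub[of "fedge v"] by auto
      moreover have "c \<in> out_arcs W (fedge v)" "d \<in> out_arcs W (fedge v)"
        using cd by auto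
      ultimately show ?thesis
        by (auto simp: out_arcs_W[OF span v])
    next
      assume 4: "out_degree W (fedge v) = 4"
      show ?thesis
      proof (rule ccontr)
        assume "\<not> ?thesis"
        then have "out_arcs W (fedge v) \<subseteq> {a \<in> arcs G - arcs F. tail G a = mate v}"
          using spanW(2) by (auto simp: out_arcs_W[OF span v])
        moreover have "card {a \<in> arcs G - arcs F. tail G a = mate v} = 2"
          using card_non_factor_arcs[OF cubic] v by simp
        ultimately have "card (out_arcs W (fedge v)) \<le> 2"
          by (metis (no_types, lifting) card_ge_0_finite card_mono zero_less_numeral)
        then show False
          using 4 by (simp add: out_degree_def)
      qed
    qed
    then obtain c where c: "c \<in> arcs W" "tail G c = v"
      by blast
    obtain i where i: "i < n" "p ! i = c \<or> arev (p ! i) = c"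
      using covered[OF c(1)] by blast
    have mem: "v \<in> tail G ` set (g i) \<Longrightarrow> i < n \<Longrightarrow> v \<in> tail G ` set q" for i
      by (auto simp: set_q)
    from i(2) show "v \<in> tail G ` set q"
    proof
      assume "p ! i = c"
      then show ?thesis
        using c(2) i(1) by (intro mem[of i]) (auto simp: g_def)
    next
      \<comment> \<open>The tour enters \<open>v\<close> here, so \<open>v\<close> is the tail of
        the inserted arc at a jump and of the next tour arc otherwise.\<close>
      assume "arev (p ! i) = c"
      then have "head G (p ! i) = v"
        using c(2) pG[OF i(1)] by auto
      then show ?thesis
        using i(1) v mem[of i] mem[of "nxt i"] nxt[of i]
        by (cases "jump i") (auto simp: g_def jump_def)
    qed
  qed (use q_arcs in auto)
  ultimately show ?thesis
    using that unfolding hamiltonian_cycle_def by blast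
qed

end

theorem theorem4:
  fixes G F :: "('a, 'b) pre_digraph" and arev :: "'b \<Rightarrow> 'b"
  assumes "bidirected_digraph G arev" and "fin_digraph G"
    and "connected G" and "cubic G"
    and "factor 1 F G arev"
  shows "hamiltonian G arev \<longleftrightarrow> (\<exists>W. good_eulerian_subgraph G arev F W)"
proof -
  interpret one_factor G arev F
    using assms(1,5) by (simp add: one_factor_def one_factor_axioms_def)
  show ?thesis
    unfolding hamiltonian_def
    using hamiltonian_imp_good_eulerian_subgraph good_eulerian_subgraph_imp_hamiltonian[OF assms(4)]
    by metis
qed

end
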